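(* Let $\mathcal{D}$ be a dense subspace of a complex Hilbert space $\mathcal{H}$, endowed with the graph topology $t_\dagger$, and let $X\in\mathfrak{L}_{\mathsf B}(\mathcal{D},\mathcal{D}^\times)$. The following statements are equivalent. (i) $X$ maps $\mathcal{D}$ into $\mathcal{H}$ and $\overline{X}\in\mathfrak{B}(\mathcal{H})$ (the closure of $X$, regarded as an operator in $\mathcal{H}$ with domain $\mathcal{D}$, is a bounded everywhere defined operator on $\mathcal{H}$). (ii) $X\in\mathfrak{L}_{\mathsf B}(\mathcal{D},\mathcal{D}^\times)_b$, i.e. $X$ is a bounded element. (iii) There exists $\lambda>0$ such that $$-\lambda I\le \Re(X)\le\lambda I,\qquad -\lambda I\le\Im(X)\le\lambda I,$$ where $\Re(X)=\frac{X+X^\dagger}{2}$ and $\Im(X)=\frac{X-X^\dagger}{2i}$.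
   Context: $\mathcal{L}^\dagger(\mathcal{D})$ is the set of all linear operators $A:\mathcal{D}\to\mathcal{D}$ such that $\mathcal{D}\subseteq D(A^* )$ and $A^*\mathcal{D}\subseteq\mathcal{D}$. For $A\in\mathcal{L}^\dagger(\mathcal{D})$ put $\|\xi\|_A=\sqrt{\|\xi\|^2+\|A\xi\|^2}$, $\xi\in\mathcal{D}$; the graph topology $t_\dagger$ on $\mathcal{D}$ is the locally convex topology defined by the norms $\|\cdot\|_A$, $A\in\mathcal{L}^\dagger(\mathcal{D})$. $\mathcal{H}_A$ is the Hilbert space $D(\overline A)$ with the graph norm $\|\cdot\|_A$ (inner product $\langle\cdot|\cdot\rangle_A$, $\langle\xi|\eta\rangle_A=\langle\xi|\eta\rangle+\langle\overline A\xi|\overline A\eta\rangle$); $\|\cdot\|_{A,A}$ is the operator norm of $\mathfrak{B}(\mathcal{H}_A)$. Inner products are linear in the first variable. $\mathcal{D}^\times$ is the space of all continuous conjugate linear functionals on $\mathcal{D}[t_\dagger]$, with the strong dual topology; $\langle F|\eta\rangle$ denotes the value of $F\in\mathcal{D}^\times$ at $\eta\in\mathcal{D}$, and $h\in\mathcal{H}$ is identified with the functional $\eta\mapsto\langle h|\eta\rangle$, so $\mathcal{D}\subset\mathcal{H}\subset\mathcal{D}^\times$. $\mathfrak{L}_{\mathsf B}(\mathcal{D},\mathcal{D}^\times)$ is the space of all continuous linear maps $X:\mathcal{D}[t_\dagger]\to\mathcal{D}^\times$ for which the sesquilinear form $\theta_X(\xi,\eta)=\langle X\xi|\eta\rangle$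 is jointly continuous on $\mathcal{D}\times\mathcal{D}$, i.e. there are $\gamma_X>0$ and $A\in\mathcal{L}^\dagger(\mathcal{D})$ with $|\langle X\xi|\eta\rangle|\le\gamma_X\|\xi\|_A\|\eta\|_A$ for all $\xi,\eta\in\mathcal{D}$. The involution $X\mapsto X^\dagger$ is given by $\langle X\xi|\eta\rangle=\overline{\langle X^\dagger\eta|\xi\rangle}$, $\xi,\eta\in\mathcal{D}$. $I$ denotes the inclusion $\mathcal{D}\hookrightarrow\mathcal{D}^\times$. $X$ has a representative in $\mathfrak{B}(\mathcal{H}_A)$ if there is (a necessarily unique) $X_A\in\mathfrak{B}(\mathcal{H}_A)$ with $\langle X\xi|\eta\rangle=\langle X_A\xi|\eta\rangle_A$ for all $\xi,\eta\in\mathcal{D}$. $X$ is a bounded element if it has a representative $X_A$ in $\mathfrak{B}(\mathcal{H}_A)$ for every $A\in\mathcal{L}^\dagger(\mathcal{D})$ and $\|X\|_b:=\sup_{A\in\mathcal{L}^\dagger(\mathcal{D})}\|X_A\|_{A,A}<\infty$; the set of bounded elements is $\mathfrak{L}_{\mathsf B}(\mathcal{D},\mathcal{D}^\times)_b$. Order: $X\ge0$ means $\langle X\xi|\xi\rangle\ge0$ for all $\xi\in\mathcal{D}$; $X\le Y$ means $Y-X\ge0$. *)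

theory Defs
  imports "HOL-Analysis.Analysis"
begin

section \<open>Complex Hilbert spaces\<close>

class complex_inner_space = real_normed_vector +
  fixes scaleC :: "complex \<Rightarrow> 'a \<Rightarrow> 'a"  (infixr "*\<^sub>C" 75)
    and cinner :: "'a \<Rightarrow> 'a \<Rightarrow> complex"
  assumes scaleC_add_right: "c *\<^sub>C (x + y) = c *\<^sub>C x + c *\<^sub>C y"
    and scaleC_add_left: "(c + d) *\<^sub>C x = c *\<^sub>C x + d *\<^sub>C x"
    and scaleC_scaleC: "c *\<^sub>C d *\<^sub>C x = (c * d) *\<^sub>C x"
    and scaleC_one: "1 *\<^sub>C x = x"
    and scaleR_scaleC: "r *\<^sub>R x = complex_of_real r *\<^sub>C x"
    and cinner_add_left: "cinner (x + y) z = cinner x z + cinner y z"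
    and cinner_scaleC_left: "cinner (c *\<^sub>C x) y = c * cinner x y"
    and cinner_commute: "cinner y x = cnj (cinner x y)"
    and cinner_self_nonneg: "cinner x x \<in> \<real>\<^sub>\<ge>\<^sub>0"
    and norm_eq_sqrt_cinner: "norm x = sqrt (Re (cinner x x))"

class complex_hilbert_space = complex_inner_space + complete_space

definition csubspace :: "'h::complex_inner_space set \<Rightarrow> bool" where
  "csubspace S \<longleftrightarrow> 0 \<in> S \<and> (\<forall>x\<in>S. \<forall>y\<in>S. x + y \<in> S) \<and> (\<forall>c. \<forall>x\<in>S. c *\<^sub>C x \<in> S)"

definition clinear_on :: "'h::complex_inner_space set \<Rightarrow> ('h \<Rightarrow> 'h) \<Rightarrow> bool" where
  "clinear_on S T \<longleftrightarrow>
     (\<forall>x\<in>S. \<forall>y\<in>S. T (x + y) = T x + T y) \<and> (\<forall>c. \<forall>x\<in>S. T (c *\<^sub>C x) = c *\<^sub>C T x)"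


section \<open>Unbounded operators\<close>

text \<open>An operator in the Hilbert space is given by its domain \<open>D\<close> and a function, of which only the
  values on \<open>D\<close> matter. The inner product is linear in the first argument. \<open>adj\<close> and \<open>closure_op\<close>
  are meaningful for a dense \<open>D\<close> and a closable operator, respectively.\<close>

definition adj_dom :: "'h::complex_inner_space set \<Rightarrow> ('h \<Rightarrow> 'h) \<Rightarrow> 'h set" where
  "adj_dom D A = {\<eta>. \<exists>\<zeta>. \<forall>\<xi>\<in>D. cinner (A \<xi>) \<eta> = cinner \<xi> \<zeta>}"

definition adj :: "'h::complex_inner_space set \<Rightarrow> ('h \<Rightarrow> 'h) \<Rightarrow> 'h \<Rightarrow> 'h" where
  "adj D A \<eta> = (THE \<zeta>. \<forall>\<xi>\<in>D. cinner (A \<xi>) \<eta> = cinner \<xi> \<zeta>)"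

definition op_graph :: "'h set \<Rightarrow> ('h \<Rightarrow> 'h) \<Rightarrow> ('h \<times> 'h) set" where
  "op_graph D A = {(\<xi>, A \<xi>) |\<xi>. \<xi> \<in> D}"

definition closable :: "'h::complex_inner_space set \<Rightarrow> ('h \<Rightarrow> 'h) \<Rightarrow> bool" where
  "closable D A \<longleftrightarrow> single_valued (closure (op_graph D A))"

definition closure_dom :: "'h::complex_inner_space set \<Rightarrow> ('h \<Rightarrow> 'h) \<Rightarrow> 'h set" where
  "closure_dom D A = Domain (closure (op_graph D A))"

definition closure_op :: "'h::complex_inner_space set \<Rightarrow> ('h \<Rightarrow> 'h) \<Rightarrow> 'h \<Rightarrow> 'h" where
  "closure_op D A \<xi> = (THE \<zeta>. (\<xi>, \<zeta>) \<in> closure (op_graph D A))"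

definition L_dagger :: "'h::complex_inner_space set \<Rightarrow> ('h \<Rightarrow> 'h) set" where
  "L_dagger D = {A \<in> D \<rightarrow>\<^sub>E D. clinear_on D A \<and> D \<subseteq> adj_dom D A \<and> adj D A ` D \<subseteq> D}"


section \<open>The graph topology and the spaces \<open>H\<^sub>A\<close>\<close>

definition graph_norm :: "('h::complex_inner_space \<Rightarrow> 'h) \<Rightarrow> 'h \<Rightarrow> real" where
  "graph_norm A \<xi> = sqrt ((norm \<xi>)\<^sup>2 + (norm (A \<xi>))\<^sup>2)"

definition graph_inner :: "('h::complex_inner_space \<Rightarrow> 'h) \<Rightarrow> 'h \<Rightarrow> 'h \<Rightarrow> complex" where
  "graph_inner A \<xi> \<eta> = cinner \<xi> \<eta> + cinner (A \<xi>) (A \<eta>)"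

definition graph_topology :: "'h::complex_inner_space set \<Rightarrow> 'h topology" where
  "graph_topology D = topology_generated_by
     {{\<eta> \<in> D. graph_norm A (\<eta> - \<xi>) < \<epsilon>} |A \<xi> \<epsilon>. A \<in> L_dagger D \<and> \<xi> \<in> D \<and> \<epsilon> > 0}"

definition graph_bounded :: "'h::complex_inner_space set \<Rightarrow> 'h set \<Rightarrow> bool" where
  "graph_bounded D M \<longleftrightarrow> M \<subseteq> D \<and> (\<forall>A\<in>L_dagger D. bdd_above (graph_norm A ` M))"

text \<open>\<open>B_HA D A\<close> is the set of bounded operators on the Hilbert space \<open>closure_dom D A\<close> with inner
  product \<open>graph_inner (closure_op D A)\<close>, and \<open>norm_HA D A\<close> is its operator norm.\<close>

definition B_HA :: "'h::complex_inner_space set \<Rightarrow> ('h \<Rightarrow> 'h) \<Rightarrow> ('h \<Rightarrow> 'h) set" where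
  "B_HA D A = {T \<in> closure_dom D A \<rightarrow>\<^sub>E closure_dom D A. clinear_on (closure_dom D A) T \<and>
     (\<exists>K. \<forall>\<xi>\<in>closure_dom D A.
        graph_norm (closure_op D A) (T \<xi>) \<le> K * graph_norm (closure_op D A) \<xi>)}"

definition norm_HA :: "'h::complex_inner_space set \<Rightarrow> ('h \<Rightarrow> 'h) \<Rightarrow> ('h \<Rightarrow> 'h) \<Rightarrow> real" where
  "norm_HA D A T =
     (SUP \<xi>\<in>{\<xi> \<in> closure_dom D A. graph_norm (closure_op D A) \<xi> \<le> 1}.
        graph_norm (closure_op D A) (T \<xi>))"


section \<open>The conjugate dual of \<open>D\<close>\<close>

text \<open>Functionals on \<open>D\<close>, and maps from \<open>D\<close> to functionals, are extensional (\<^const>\<open>undefined\<close> off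
  \<open>D\<close>), so that equality of functions is equality on \<open>D\<close>. The value of \<open>F\<close> at \<open>\<eta>\<close> is \<open>F \<eta>\<close>.\<close>

definition conj_dual :: "'h::complex_inner_space set \<Rightarrow> ('h \<Rightarrow> complex) set" where
  "conj_dual D = {F \<in> extensional D.
     (\<forall>\<xi>\<in>D. \<forall>\<eta>\<in>D. F (\<xi> + \<eta>) = F \<xi> + F \<eta>) \<and> (\<forall>c. \<forall>\<xi>\<in>D. F (c *\<^sub>C \<xi>) = cnj c * F \<xi>) \<and>
     continuous_map (graph_topology D) euclidean F}"

text \<open>The strong topology is that of uniform convergence on the bounded sets of \<open>D\<close>.\<close>

definition strong_dual_topology :: "'h::complex_inner_space set \<Rightarrow> ('h \<Rightarrow> complex) topology" where
  "strong_dual_topology D = topology_generated_by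
     {{G \<in> conj_dual D. (SUP \<eta>\<in>M. cmod (G \<eta> - F \<eta>)) < \<epsilon>} |F M \<epsilon>.
        F \<in> conj_dual D \<and> graph_bounded D M \<and> M \<noteq> {} \<and> \<epsilon> > 0}"

definition embed :: "'h::complex_inner_space set \<Rightarrow> 'h \<Rightarrow> 'h \<Rightarrow> complex" where
  "embed D h = (\<lambda>\<eta>\<in>D. cinner h \<eta>)"

definition L_B :: "'h::complex_inner_space set \<Rightarrow> ('h \<Rightarrow> 'h \<Rightarrow> complex) set" where
  "L_B D = {X \<in> D \<rightarrow>\<^sub>E conj_dual D.
     (\<forall>\<xi>\<in>D. \<forall>\<xi>'\<in>D. \<forall>\<eta>\<in>D. X (\<xi> + \<xi>') \<eta> = X \<xi> \<eta> + X \<xi>' \<eta>) \<and>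
     (\<forall>c. \<forall>\<xi>\<in>D. \<forall>\<eta>\<in>D. X (c *\<^sub>C \<xi>) \<eta> = c * X \<xi> \<eta>) \<and>
     continuous_map (graph_topology D) (strong_dual_topology D) X \<and>
     (\<exists>\<gamma>>0. \<exists>A\<in>L_dagger D. \<forall>\<xi>\<in>D. \<forall>\<eta>\<in>D.
        cmod (X \<xi> \<eta>) \<le> \<gamma> * graph_norm A \<xi> * graph_norm A \<eta>)}"

definition map_I :: "'h::complex_inner_space set \<Rightarrow> 'h \<Rightarrow> 'h \<Rightarrow> complex" where
  "map_I D = (\<lambda>\<xi>\<in>D. embed D \<xi>)"

definition map_plus :: "'h set \<Rightarrow> ('h \<Rightarrow> 'h \<Rightarrow> complex) \<Rightarrow> ('h \<Rightarrow> 'h \<Rightarrow> complex) \<Rightarrow> 'h \<Rightarrow> 'h \<Rightarrow> complex" where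
  "map_plus D X Y = (\<lambda>\<xi>\<in>D. \<lambda>\<eta>\<in>D. X \<xi> \<eta> + Y \<xi> \<eta>)"

definition map_minus :: "'h set \<Rightarrow> ('h \<Rightarrow> 'h \<Rightarrow> complex) \<Rightarrow> ('h \<Rightarrow> 'h \<Rightarrow> complex) \<Rightarrow> 'h \<Rightarrow> 'h \<Rightarrow> complex" where
  "map_minus D X Y = (\<lambda>\<xi>\<in>D. \<lambda>\<eta>\<in>D. X \<xi> \<eta> - Y \<xi> \<eta>)"

definition map_scale :: "'h set \<Rightarrow> complex \<Rightarrow> ('h \<Rightarrow> 'h \<Rightarrow> complex) \<Rightarrow> 'h \<Rightarrow> 'h \<Rightarrow> complex" where
  "map_scale D c X = (\<lambda>\<xi>\<in>D. \<lambda>\<eta>\<in>D. c * X \<xi> \<eta>)"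

definition map_dagger :: "'h set \<Rightarrow> ('h \<Rightarrow> 'h \<Rightarrow> complex) \<Rightarrow> 'h \<Rightarrow> 'h \<Rightarrow> complex" where
  "map_dagger D X = (\<lambda>\<xi>\<in>D. \<lambda>\<eta>\<in>D. cnj (X \<eta> \<xi>))"

definition map_Re :: "'h set \<Rightarrow> ('h \<Rightarrow> 'h \<Rightarrow> complex) \<Rightarrow> 'h \<Rightarrow> 'h \<Rightarrow> complex" where
  "map_Re D X = map_scale D (1 / 2) (map_plus D X (map_dagger D X))"

definition map_Im :: "'h set \<Rightarrow> ('h \<Rightarrow> 'h \<Rightarrow> complex) \<Rightarrow> 'h \<Rightarrow> 'h \<Rightarrow> complex" where
  "map_Im D X = map_scale D (1 / (2 * \<i>)) (map_minus D X (map_dagger D X))"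

definition map_nonneg :: "'h set \<Rightarrow> ('h \<Rightarrow> 'h \<Rightarrow> complex) \<Rightarrow> bool" where
  "map_nonneg D X \<longleftrightarrow> (\<forall>\<xi>\<in>D. X \<xi> \<xi> \<in> \<real>\<^sub>\<ge>\<^sub>0)"

definition map_leq :: "'h set \<Rightarrow> ('h \<Rightarrow> 'h \<Rightarrow> complex) \<Rightarrow> ('h \<Rightarrow> 'h \<Rightarrow> complex) \<Rightarrow> bool" where
  "map_leq D X Y \<longleftrightarrow> map_nonneg D (map_minus D Y X)"


section \<open>Bounded elements\<close>

definition is_representative ::
    "'h::complex_inner_space set \<Rightarrow> ('h \<Rightarrow> 'h) \<Rightarrow> ('h \<Rightarrow> 'h \<Rightarrow> complex) \<Rightarrow> ('h \<Rightarrow> 'h) \<Rightarrow> bool" where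
  "is_representative D A X T \<longleftrightarrow> T \<in> B_HA D A \<and>
     (\<forall>\<xi>\<in>D. \<forall>\<eta>\<in>D. X \<xi> \<eta> = graph_inner (closure_op D A) (T \<xi>) \<eta>)"

definition representative ::
    "'h::complex_inner_space set \<Rightarrow> ('h \<Rightarrow> 'h) \<Rightarrow> ('h \<Rightarrow> 'h \<Rightarrow> complex) \<Rightarrow> 'h \<Rightarrow> 'h" where
  "representative D A X = (THE T. is_representative D A X T)"

definition norm_b :: "'h::complex_inner_space set \<Rightarrow> ('h \<Rightarrow> 'h \<Rightarrow> complex) \<Rightarrow> ereal" where
  "norm_b D X = (SUP A\<in>L_dagger D. ereal (norm_HA D A (representative D A X)))"

definition L_B_bounded :: "'h::complex_inner_space set \<Rightarrow> ('h \<Rightarrow> 'h \<Rightarrow> complex) set" where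
  "L_B_bounded D =
     {X \<in> L_B D. (\<forall>A\<in>L_dagger D. \<exists>T. is_representative D A X T) \<and> norm_b D X < \<infinity>}"


section \<open>Maps with values in the Hilbert space\<close>

definition maps_into_H :: "'h::complex_inner_space set \<Rightarrow> ('h \<Rightarrow> 'h \<Rightarrow> complex) \<Rightarrow> bool" where
  "maps_into_H D X \<longleftrightarrow> X ` D \<subseteq> range (embed D)"

text \<open>\<open>X\<close> regarded as an operator in the Hilbert space with domain \<open>D\<close>, provided that
  \<^term>\<open>maps_into_H D X\<close> holds.\<close>

definition as_operator :: "'h::complex_inner_space set \<Rightarrow> ('h \<Rightarrow> 'h \<Rightarrow> complex) \<Rightarrow> 'h \<Rightarrow> 'h" where
  "as_operator D X = (\<lambda>\<xi>\<in>D. THE h. X \<xi> = embed D h)"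

definition closure_bounded_everywhere ::
    "'h::complex_inner_space set \<Rightarrow> ('h \<Rightarrow> 'h) \<Rightarrow> bool" where
  "closure_bounded_everywhere D T \<longleftrightarrow> closable D T \<and> closure_dom D T = UNIV \<and>
     clinear_on UNIV (closure_op D T) \<and> (\<exists>K. \<forall>x. norm (closure_op D T x) \<le> K * norm x)"

end

theory Submission
  imports Defs
begin

text \<open>Each of the three statements is equivalent to boundedness of the form \<open>X\<close>, i.e. to
  \<open>\<bar>\<langle>X\<xi>|\<eta>\<rangle>\<bar> \<le> K \<parallel>\<xi>\<parallel> \<parallel>\<eta>\<parallel>\<close> on \<open>D\<close>. A bounded form on a subspace of a Hilbert space is represented
  by an operator on the closure of the subspace (Riesz); applied to \<open>D\<close> in \<open>H\<close> this gives the bounded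
  operator of (i), and applied to the graph of \<open>A\<close> in \<open>H \<times> H\<close> it gives the representative in
  \<open>B(H\<^sub>A)\<close>, with norm at most \<open>K\<close> for every \<open>A\<close>. Conversely, \<open>A = 0\<close> recovers the bound from (ii),
  and (iii) bounds the diagonal of the form, hence the form by polarization.\<close>

section \<open>Complex inner product spaces\<close>

lemma cinner_add_right: "cinner x (y + z) = cinner x y + cinner x z"
  by (metis cinner_add_left cinner_commute complex_cnj_add)

lemma cinner_scaleC_right: "cinner x (c *\<^sub>C y) = cnj c * cinner x y"
  by (metis cinner_commute cinner_scaleC_left complex_cnj_mult)

lemma cinner_scaleR_left: "cinner (r *\<^sub>R x) y = complex_of_real r * cinner x y"
  by (simp add: scaleR_scaleC cinner_scaleC_left)

lemma cinner_scaleR_right: "cinner x (r *\<^sub>R y) = complex_of_real r * cinner x y"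
  by (simp add: scaleR_scaleC cinner_scaleC_right)

lemma cinner_minus_left: "cinner (- x) y = - cinner x y"
  using cinner_scaleR_left[of "-1" x y] by simp

lemma cinner_minus_right: "cinner x (- y) = - cinner x y"
  using cinner_scaleR_right[of x "-1" y] by simp

lemma cinner_diff_left: "cinner (x - y) z = cinner x z - cinner y z"
  using cinner_add_left[of x "- y" z] by (simp add: cinner_minus_left)

lemma cinner_zero_left [simp]: "cinner 0 y = 0"
  using cinner_scaleR_left[of 0 0 y] by simp

lemma cinner_zero_right [simp]: "cinner x 0 = 0"
  using cinner_scaleR_right[of x 0 0] by simp

lemma scaleC_zero_right [simp]: "c *\<^sub>C (0::'h::complex_inner_space) = 0"
  using scaleC_add_right[of c "0::'h" 0] by simp

lemma scaleC_zero_left [simp]: "0 *\<^sub>C (x::'h::complex_inner_space) = 0"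
  using scaleR_scaleC[of 0 x] by simp

lemma scaleC_minus_one: "(-1) *\<^sub>C x = - (x::'h::complex_inner_space)"
  using scaleR_scaleC[of "-1" x] by simp

lemma cinner_self: "cinner x x = complex_of_real ((norm x)\<^sup>2)"
proof -
  obtain r where "cinner x x = complex_of_real r" "0 \<le> r"
    using cinner_self_nonneg[of x] by (auto simp: nonneg_Reals_def)
  then show ?thesis by (simp add: norm_eq_sqrt_cinner del: of_real_power)
qed

lemma norm_scaleC: "norm (c *\<^sub>C x) = cmod c * norm (x::'h::complex_inner_space)"
proof -
  have "complex_of_real ((norm (c *\<^sub>C x))\<^sup>2) = c * cnj c * complex_of_real ((norm x)\<^sup>2)"
    unfolding cinner_self[symmetric] by (simp add: cinner_scaleC_left cinner_scaleC_right)
  also have "\<dots> = complex_of_real ((cmod c * norm x)\<^sup>2)"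
    by (simp add: power_mult_distrib flip: complex_norm_square)
  finally show ?thesis
    by (simp only: of_real_eq_iff power2_eq_iff_nonneg norm_ge_zero mult_nonneg_nonneg)
qed

lemma norm_add_squared:
  "(norm (x + y))\<^sup>2 = (norm x)\<^sup>2 + 2 * Re (cinner x y) + (norm (y::'h::complex_inner_space))\<^sup>2"
proof -
  have "Re (cinner (x + y) (x + y)) = Re (cinner x x) + 2 * Re (cinner x y) + Re (cinner y y)"
    by (simp add: cinner_add_left cinner_add_right cinner_commute[of y x])
  then show ?thesis by (simp add: cinner_self)
qed

lemma norm_diff_squared:
  "(norm (x - y))\<^sup>2 = (norm x)\<^sup>2 - 2 * Re (cinner x y) + (norm (y::'h::complex_inner_space))\<^sup>2"
  using norm_add_squared[of x "- y"] by (simp add: cinner_minus_right)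

text \<open>The triangle inequality is a class axiom, so the real part of Cauchy--Schwarz is read off from
  the expansion of the norm of \<open>x + y\<close>.\<close>

lemma Re_cinner_le: "Re (cinner x y) \<le> norm x * norm y"
proof -
  have "(norm (x + y))\<^sup>2 \<le> (norm x + norm y)\<^sup>2"
    by (simp add: norm_triangle_ineq power_mono)
  then show ?thesis by (simp add: norm_add_squared power2_sum)
qed

lemma cmod_cinner_le: "cmod (cinner x y) \<le> norm x * norm y"
proof (cases "cinner x y = 0")
  case False
  \<comment> \<open>The unimodular factor \<open>c\<close> rotates \<open>cinner x y\<close> onto
    the positive real axis, which reduces the claim to \<open>Re_cinner_le\<close>.\<close>
  define c where "c = cnj (sgn (cinner x y))"
  have "c * cinner x y = complex_of_real (cmod (cinner x y))"
    using False complex_norm_square[of "cinner x y"]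
    by (simp add: c_def sgn_eq divide_simps power2_eq_square mult.commute)
  then have "cmod (cinner x y) = Re (cinner (c *\<^sub>C x) y)"
    by (simp add: cinner_scaleC_left)
  also have "\<dots> \<le> norm (c *\<^sub>C x) * norm y" by (rule Re_cinner_le)
  also have "\<dots> = norm x * norm y" using False by (simp add: norm_scaleC c_def norm_sgn)
  finally show ?thesis .
qed simp

lemma bounded_bilinear_cinner:
  "bounded_bilinear (cinner :: 'h::complex_inner_space \<Rightarrow> 'h \<Rightarrow> complex)"
  by standard
    (auto simp: cinner_add_left cinner_add_right cinner_scaleR_left cinner_scaleR_right
      scaleR_conv_of_real intro!: exI[of _ 1] cmod_cinner_le)

lemmas tendsto_cinner [tendsto_intros] = bounded_bilinear.tendsto[OF bounded_bilinear_cinner]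

lemma bounded_linear_scaleC: "bounded_linear (\<lambda>x::'h::complex_inner_space. c *\<^sub>C x)"
  by (rule bounded_linear_intro[of _ "cmod c"])
    (auto simp: scaleC_add_right scaleR_scaleC scaleC_scaleC norm_scaleC mult.commute)

lemmas tendsto_scaleC [tendsto_intros] = bounded_linear.tendsto[OF bounded_linear_scaleC]

lemma csubspaceD:
  assumes "csubspace S"
  shows "0 \<in> S" "x \<in> S \<Longrightarrow> y \<in> S \<Longrightarrow> x + y \<in> S" "x \<in> S \<Longrightarrow> c *\<^sub>C x \<in> S"
    "x \<in> S \<Longrightarrow> r *\<^sub>R x \<in> S" "x \<in> S \<Longrightarrow> y \<in> S \<Longrightarrow> x - y \<in> S"
proof -
  show *: "0 \<in> S" "x \<in> S \<Longrightarrow> y \<in> S \<Longrightarrow> x + y \<in> S" "x \<in> S \<Longrightarrow> c *\<^sub>C x \<in> S"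
    "x \<in> S \<Longrightarrow> r *\<^sub>R x \<in> S" for x y c r
    using assms by (auto simp: csubspace_def scaleR_scaleC)
  show "x \<in> S \<Longrightarrow> y \<in> S \<Longrightarrow> x - y \<in> S"
    using *(2)[of x "(-1) *\<^sub>R y"] *(4)[of y "-1"] by simp
qed

lemma csubspace_closure:
  assumes "csubspace S"
  shows "csubspace (closure S)"
  unfolding csubspace_def
proof (intro conjI ballI allI)
  show "0 \<in> closure S" using csubspaceD(1)[OF assms] closure_subset by blast
next
  fix x y assume "x \<in> closure S" "y \<in> closure S"
  then obtain u v where "\<And>n. u n \<in> S" "u \<longlonglongrightarrow> x" "\<And>n. v n \<in> S" "v \<longlonglongrightarrow> y"
    unfolding closure_sequential by blast
  then show "x + y \<in> closure S"
    unfolding closure_sequential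
    by (intro exI[of _ "\<lambda>n. u n + v n"]) (auto intro: csubspaceD[OF assms] tendsto_add)
next
  fix x c assume "x \<in> closure S"
  then obtain u where "\<And>n. u n \<in> S" "u \<longlonglongrightarrow> x"
    unfolding closure_sequential by blast
  then show "c *\<^sub>C x \<in> closure S"
    unfolding closure_sequential
    by (intro exI[of _ "\<lambda>n. c *\<^sub>C u n"]) (auto intro: csubspaceD[OF assms] tendsto_scaleC)
qed

lemma clinear_onD:
  assumes "clinear_on S T"
  shows "x \<in> S \<Longrightarrow> y \<in> S \<Longrightarrow> T (x + y) = T x + T y" "x \<in> S \<Longrightarrow> T (c *\<^sub>C x) = c *\<^sub>C T x"
  using assms by (auto simp: clinear_on_def)

lemma clinear_on_0:
  assumes "clinear_on S T" "csubspace S"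
  shows "T 0 = 0"
  using clinear_onD(2)[OF assms(1) csubspaceD(1)[OF assms(2)], of 0] by simp

lemma clinear_on_diff:
  assumes "clinear_on S T" "csubspace S" "x \<in> S" "y \<in> S"
  shows "T (x - y) = T x - T y"
  using clinear_onD(1)[OF assms(1), of x "(-1) *\<^sub>C y"] clinear_onD(2)[OF assms(1), of y "-1"]
    csubspaceD(3)[OF assms(2), of y "-1"] assms(3,4)
  by (simp add: scaleC_minus_one)

text \<open>By continuity, orthogonality to \<open>V\<close> extends to its closure, so
  \<open>x\<close> is orthogonal to itself. All later uniqueness arguments rest on this: a vector of
  \<open>closure V\<close> is determined by its inner products with \<open>V\<close>.\<close>

lemma orthogonal_closure_eq_0:
  assumes "x \<in> closure V" and "\<And>v. v \<in> V \<Longrightarrow> cinner x v = 0"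
  shows "x = 0"
proof -
  obtain u where u: "\<And>n. u n \<in> V" "u \<longlonglongrightarrow> x"
    using assms(1) unfolding closure_sequential by blast
  have "(\<lambda>n. cinner x (u n)) \<longlonglongrightarrow> cinner x x" by (intro tendsto_intros u)
  then have "cinner x x = 0" using u(1) assms(2) by (simp add: LIMSEQ_const_iff)
  then show ?thesis by (simp add: cinner_self)
qed

text \<open>Graphs of operators are subspaces of H x H. The componentwise sum of inner products
  induces exactly the norm that the product type already carries, so H x H is again a Hilbert space
  and the results on subspaces apply to graphs.\<close>

instantiation prod :: (complex_inner_space, complex_inner_space) complex_inner_space
begin

definition scaleC_prod :: "complex \<Rightarrow> 'a \<times> 'b \<Rightarrow> 'a \<times> 'b" where
  "scaleC_prod c p = (c *\<^sub>C fst p, c *\<^sub>C snd p)"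

definition cinner_prod :: "'a \<times> 'b \<Rightarrow> 'a \<times> 'b \<Rightarrow> complex" where
  "cinner_prod p q = cinner (fst p) (fst q) + cinner (snd p) (snd q)"

instance
proof
  fix p q :: "'a \<times> 'b"
  show "cinner q p = cnj (cinner p q)"
    using cinner_commute[of "fst q" "fst p"] cinner_commute[of "snd q" "snd p"]
    by (simp add: cinner_prod_def)
qed (auto simp: scaleC_prod_def cinner_prod_def scaleC_add_right scaleC_add_left scaleC_scaleC
    scaleC_one scaleR_scaleC cinner_add_left cinner_scaleC_left cinner_self norm_prod_def
    algebra_simps prod_eq_iff nonneg_Reals_def simp flip: of_real_add of_real_power)

end

instance prod :: (complex_hilbert_space, complex_hilbert_space) complex_hilbert_space ..


section \<open>Bounded sesquilinear forms on a subspace\<close>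

text \<open>The vector \<open>h\<close> is the limit of a minimising sequence of the functional
  \<open>J\<close> on \<open>V\<close>. Since \<open>V\<close> is not assumed closed and
  \<open>f\<close> is controlled on \<open>V\<close> only, \<open>h\<close> is placed in
  \<open>closure V\<close> and \<open>J\<close> is never evaluated at \<open>h\<close>.\<close>

lemma riesz_conjugate_linear:
  fixes f :: "'k::complex_hilbert_space \<Rightarrow> complex"
  assumes V: "csubspace V" and K: "0 \<le> K"
    and add: "\<And>x y. x \<in> V \<Longrightarrow> y \<in> V \<Longrightarrow> f (x + y) = f x + f y"
    and scale: "\<And>c x. x \<in> V \<Longrightarrow> f (c *\<^sub>C x) = cnj c * f x"
    and bound: "\<And>x. x \<in> V \<Longrightarrow> cmod (f x) \<le> K * norm x"
  obtains h where "h \<in> closure V" "\<And>y. y \<in> V \<Longrightarrow> f y = cinner h y" "norm h \<le> K"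
proof -
  \<comment> \<open>If \<open>f y = cinner h y\<close>, then
    \<open>J y = (norm (y - h))^2 - (norm h)^2\<close>, so minimising \<open>J\<close> amounts to
    approaching \<open>h\<close>.\<close>
  define J where "J y = (norm y)\<^sup>2 - 2 * Re (f y)" for y
  define m where "m = Inf (J ` V)"
  have scaleR: "f (r *\<^sub>R x) = complex_of_real r * f x" if "x \<in> V" for r x
    using scale[OF that] by (simp add: scaleR_scaleC)
  have J_ge: "- (K\<^sup>2) \<le> J y" if "y \<in> V" for y
  proof -
    have "Re (f y) \<le> K * norm y" using bound[OF that] complex_Re_le_cmod order_trans by blast
    moreover have "0 \<le> (norm y - K)\<^sup>2" by simp
    ultimately show ?thesis by (simp add: J_def power2_diff algebra_simps)
  qed
  have bdd: "bdd_below (J ` V)" using J_ge by (intro bdd_belowI2)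
  have m_le: "m \<le> J y" if "y \<in> V" for y
    unfolding m_def using bdd that by (auto intro: cInf_lower)
  have "\<exists>y\<in>V. J y < m + inverse (Suc n)" for n :: nat
    using cInf_lessD[of "J ` V" "m + inverse (Suc n)"] csubspaceD(1)[OF V]
    by (fastforce simp: m_def)
  then obtain y where yV: "\<And>n. y n \<in> V" and Jy: "\<And>n. J (y n) < m + inverse (Suc n)"
    by metis
  \<comment> \<open>Parallelogram law: the left side equals \<open>2 * (J a + J b)\<close> minus
    four times the value of \<open>J\<close> at the midpoint of \<open>a\<close> and
    \<open>b\<close>, and that value is at least \<open>m\<close>.\<close>
  have para: "(norm (a - b))\<^sup>2 \<le> 2 * (J a + J b - 2 * m)" if "a \<in> V" "b \<in> V" for a b
  proof -
    have ab: "a + b \<in> V" using csubspaceD(2)[OF V] that by blast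
    have "m \<le> J ((1/2) *\<^sub>R (a + b))" using m_le csubspaceD(4)[OF V ab] by blast
    moreover have "J ((1/2) *\<^sub>R (a + b)) = (norm (a + b))\<^sup>2 / 4 - Re (f a) - Re (f b)"
      using ab that by (simp add: J_def scaleR add power_divide add_divide_distrib del: scaleR_add_right)
    ultimately show ?thesis
      by (simp add: J_def norm_add_squared norm_diff_squared field_simps)
  qed
  have "Cauchy y"
  proof (rule metric_CauchyI)
    fix e :: real assume e: "0 < e"
    \<comment> \<open>Both values of \<open>J\<close> then exceed \<open>m\<close> by less than a
      quarter of \<open>e^2\<close>. Together that is less than one half, and \<open>para\<close>
      doubles it.\<close>
    then obtain N :: nat where N: "inverse (Suc N) < e\<^sup>2 / 4"
      using reals_Archimedean[of "e\<^sup>2 / 4"] by auto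
    have "dist (y i) (y j) < e" if "i \<ge> N" "j \<ge> N" for i j
    proof -
      have "inverse (real (Suc i)) \<le> inverse (Suc N)" "inverse (real (Suc j)) \<le> inverse (Suc N)"
        using that by (auto simp: le_imp_inverse_le)
      then have "J (y i) + J (y j) - 2 * m < 2 * (e\<^sup>2 / 4)"
        using add_strict_mono[OF Jy[of i] Jy[of j]] N by argo
      then have "(norm (y i - y j))\<^sup>2 < e\<^sup>2"
        using para[OF yV yV, of i j] by simp
      then show ?thesis using e by (simp add: dist_norm power2_less_imp_less)
    qed
    then show "\<exists>M. \<forall>i\<ge>M. \<forall>j\<ge>M. dist (y i) (y j) < e" by blast
  qed
  then obtain h where lim: "y \<longlonglongrightarrow> h" using Cauchy_convergent convergent_def by blast
  have hV: "h \<in> closure V" using lim yV unfolding closure_sequential by blast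
  have Re_eq: "Re (cinner h v) = Re (f v)" if v: "v \<in> V" for v
  proof (rule ccontr)
    define d where "d = Re (cinner h v) - Re (f v)"
    define N where "N = (norm v)\<^sup>2"
    assume "Re (cinner h v) \<noteq> Re (f v)"
    then have d: "d \<noteq> 0" by (simp add: d_def)
    have N: "0 \<le> N" by (simp add: N_def)
    \<comment> \<open>First variation in the direction \<open>v\<close>, taken at \<open>y n\<close>
      and then passed to the limit: \<open>y n\<close> minimises \<open>J\<close> up to
      \<open>inverse (Suc n)\<close>, and only \<open>cinner (y n) v\<close> depends on the limit
      point.\<close>
    have ge: "0 \<le> 2 * t * d + t\<^sup>2 * N" for t
    proof -
      have "0 \<le> inverse (real (Suc n)) + 2 * t * (Re (cinner (y n) v) - Re (f v)) + t\<^sup>2 * N" for n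
      proof -
        have tv: "t *\<^sub>R v \<in> V" using csubspaceD(4)[OF V v] .
        have "m \<le> J (y n + t *\<^sub>R v)" using m_le csubspaceD(2)[OF V yV tv] by blast
        also have "\<dots> = J (y n) + 2 * t * (Re (cinner (y n) v) - Re (f v)) + t\<^sup>2 * N"
          using tv v yV by (simp add: J_def norm_add_squared add scaleR cinner_scaleR_right N_def
              power_mult_distrib algebra_simps)
        finally show ?thesis using Jy[of n] by linarith
      qed
      moreover have "(\<lambda>n. inverse (real (Suc n)) + 2 * t * (Re (cinner (y n) v) - Re (f v)) + t\<^sup>2 * N)
          \<longlonglongrightarrow> 0 + 2 * t * d + t\<^sup>2 * N"
        unfolding d_def by (intro tendsto_intros LIMSEQ_inverse_real_of_nat lim)
      ultimately show ?thesis using LIMSEQ_le_const by fastforce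
    qed
    \<comment> \<open>This choice of \<open>t\<close> makes the quadratic negative; the denominator
      \<open>N + 1\<close> is near the minimiser and stays positive when
      \<open>v = 0\<close>.\<close>
    have "2 * (- d / (N + 1)) * d + (- d / (N + 1))\<^sup>2 * N = - (d\<^sup>2 * ((N + 2) / (N + 1)\<^sup>2))"
      using N by (simp add: divide_simps power2_eq_square) (simp add: algebra_simps)
    moreover have "0 < d\<^sup>2 * ((N + 2) / (N + 1)\<^sup>2)" using d N by simp
    ultimately show False using ge[of "- d / (N + 1)"] by linarith
  qed
  \<comment> \<open>Both sides are conjugate linear in \<open>v\<close>, so equality of the real
    parts at \<open>\<i> *\<^sub>C v\<close> is equality of the imaginary parts at
    \<open>v\<close>.\<close>
  have eq: "f v = cinner h v" if v: "v \<in> V" for v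
    using Re_eq[OF v] Re_eq[OF csubspaceD(3)[OF V v, of \<i>]] v
    by (simp add: complex_eq_iff scale cinner_scaleC_right)
  \<comment> \<open>The bound on \<open>f\<close> would give \<open>norm h \<le> K\<close> at once
    at the point \<open>h\<close>, which may lie outside \<open>V\<close>; it is therefore applied
    at \<open>y n\<close> and carried to the limit.\<close>
  have "(\<lambda>n. cmod (cinner h (y n))) \<longlonglongrightarrow> cmod (cinner h h)" "(\<lambda>n. K * norm (y n)) \<longlonglongrightarrow> K * norm h"
    by (intro tendsto_intros lim)+
  moreover have "cmod (cinner h (y n)) \<le> K * norm (y n)" for n
    using bound[OF yV] by (simp add: eq[OF yV])
  ultimately have "cmod (cinner h h) \<le> K * norm h"
    using LIMSEQ_le by blast
  then have "norm h * norm h \<le> K * norm h"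
    by (simp add: cinner_self power2_eq_square norm_mult)
  then have "norm h \<le> K" using K by (cases "norm h = 0") auto
  then show ?thesis using that hV eq by blast
qed

text \<open>Riesz gives a vector \<open>S x\<close> for each functional \<open>\<theta> x\<close>.
  Its uniqueness within \<open>closure V\<close> makes \<open>S\<close> linear, its norm bound makes
  \<open>S\<close> Lipschitz, and so \<open>S\<close> extends continuously to
  \<open>closure V\<close>. Stating the result for a general subspace covers both a dense
  \<open>D\<close> and the graph of an operator.\<close>

lemma bounded_form_representation:
  fixes \<theta> :: "'k::complex_hilbert_space \<Rightarrow> 'k \<Rightarrow> complex"
  assumes V: "csubspace V" and K: "0 \<le> K"
    and add_left: "\<And>x x' y. x \<in> V \<Longrightarrow> x' \<in> V \<Longrightarrow> y \<in> V \<Longrightarrow> \<theta> (x + x') y = \<theta> x y + \<theta> x' y"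
    and scale_left: "\<And>c x y. x \<in> V \<Longrightarrow> y \<in> V \<Longrightarrow> \<theta> (c *\<^sub>C x) y = c * \<theta> x y"
    and add_right: "\<And>x y y'. x \<in> V \<Longrightarrow> y \<in> V \<Longrightarrow> y' \<in> V \<Longrightarrow> \<theta> x (y + y') = \<theta> x y + \<theta> x y'"
    and scale_right: "\<And>c x y. x \<in> V \<Longrightarrow> y \<in> V \<Longrightarrow> \<theta> x (c *\<^sub>C y) = cnj c * \<theta> x y"
    and bound: "\<And>x y. x \<in> V \<Longrightarrow> y \<in> V \<Longrightarrow> cmod (\<theta> x y) \<le> K * norm x * norm y"
  obtains T where "T \<in> closure V \<rightarrow> closure V" "clinear_on (closure V) T"
    "\<And>x. x \<in> closure V \<Longrightarrow> norm (T x) \<le> K * norm x"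
    "\<And>x y. x \<in> V \<Longrightarrow> y \<in> V \<Longrightarrow> \<theta> x y = cinner (T x) y"
proof -
  have "\<exists>h. h \<in> closure V \<and> (\<forall>y\<in>V. \<theta> x y = cinner h y) \<and> norm h \<le> K * norm x" if x: "x \<in> V" for x
    by (rule riesz_conjugate_linear[of V "K * norm x" "\<theta> x"])
      (use V K x add_right scale_right bound in auto)
  then obtain S where S_cl: "\<And>x. x \<in> V \<Longrightarrow> S x \<in> closure V"
    and S_eq: "\<And>x y. x \<in> V \<Longrightarrow> y \<in> V \<Longrightarrow> \<theta> x y = cinner (S x) y"
    and S_norm: "\<And>x. x \<in> V \<Longrightarrow> norm (S x) \<le> K * norm x"
    by metis
  note clV = csubspace_closure[OF V]
  have S_add: "S (x + y) = S x + S y" if x: "x \<in> V" and y: "y \<in> V" for x y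
  proof -
    \<comment> \<open>The difference lies in \<open>closure V\<close> and is orthogonal to
      \<open>V\<close>, hence vanishes; the same argument treats scalar multiples.\<close>
    have "S (x + y) - (S x + S y) \<in> closure V"
      using x y by (intro csubspaceD[OF clV] S_cl csubspaceD[OF V])
    then have "S (x + y) - (S x + S y) = 0"
      by (rule orthogonal_closure_eq_0)
        (use x y csubspaceD(2)[OF V x y] in
          \<open>simp add: cinner_diff_left cinner_add_left add_left flip: S_eq\<close>)
    then show ?thesis by simp
  qed
  have S_scale: "S (c *\<^sub>C x) = c *\<^sub>C S x" if x: "x \<in> V" for c x
  proof -
    have "S (c *\<^sub>C x) - c *\<^sub>C S x \<in> closure V"
      using x by (intro csubspaceD[OF clV] S_cl csubspaceD[OF V])
    then have "S (c *\<^sub>C x) - c *\<^sub>C S x = 0"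
      by (rule orthogonal_closure_eq_0)
        (use x csubspaceD(3)[OF V x] in
          \<open>simp add: cinner_diff_left cinner_scaleC_left scale_left flip: S_eq\<close>)
    then show ?thesis by simp
  qed
  have "clinear_on V S" using S_add S_scale by (simp add: clinear_on_def)
  then have dist_S: "dist (S x) (S y) \<le> K * dist x y" if "x \<in> V" "y \<in> V" for x y
    using S_norm[OF csubspaceD(5)[OF V that]] clinear_on_diff[OF _ V that, of S]
    by (simp add: dist_norm)
  then have "K-lipschitz_on V S" using K by (simp add: lipschitz_on_def)
  then have "uniformly_continuous_on V S" by (rule lipschitz_on_uniformly_continuous)
  then obtain T where T: "uniformly_continuous_on (closure V) T"
    and TS: "\<And>x. x \<in> V \<Longrightarrow> S x = T x"
    by (rule uniformly_continuous_on_extension_on_closure) blast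
  \<comment> \<open>The approximating sequence is arbitrary, so sums and multiples of chosen
    sequences can serve for sums and multiples of points; linearity and the bound pass from
    \<open>S\<close> to \<open>T\<close> in this way.\<close>
  have lim: "(\<lambda>n. S (u n)) \<longlonglongrightarrow> T x" if "x \<in> closure V" "\<And>n. u n \<in> V" "u \<longlonglongrightarrow> x" for u x
  proof -
    have "((T \<circ> u) \<longlonglongrightarrow> T x)"
      using uniformly_continuous_imp_continuous[OF T] that closure_subset
      unfolding continuous_on_sequentially by blast
    then show ?thesis using TS that(2) by (simp add: comp_def)
  qed
  have "\<forall>x\<in>closure V. \<exists>u. (\<forall>n. u n \<in> V) \<and> u \<longlonglongrightarrow> x"
    by (auto simp: closure_sequential)
  then obtain a where a: "\<And>x n. x \<in> closure V \<Longrightarrow> a x n \<in> V" "\<And>x. x \<in> closure V \<Longrightarrow> a x \<longlonglongrightarrow> x"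
    unfolding bchoice_iff by blast
  then have Sa: "(\<lambda>n. S (a x n)) \<longlonglongrightarrow> T x" if "x \<in> closure V" for x
    using lim that by simp
  show ?thesis
  proof (rule that)
    show "T \<in> closure V \<rightarrow> closure V"
      using closed_sequentially[OF closed_closure _ Sa] S_cl a(1) by blast
    show "clinear_on (closure V) T"
      unfolding clinear_on_def
    proof (intro conjI ballI allI)
      fix x y assume x: "x \<in> closure V" and y: "y \<in> closure V"
      have "(\<lambda>n. S (a x n + a y n)) \<longlonglongrightarrow> T (x + y)"
        by (intro lim csubspaceD(2)[OF clV] csubspaceD(2)[OF V] tendsto_add a x y)
      moreover have "(\<lambda>n. S (a x n + a y n)) \<longlonglongrightarrow> T x + T y"
        using tendsto_add[OF Sa[OF x] Sa[OF y]] by (simp add: S_add a x y)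
      ultimately show "T (x + y) = T x + T y" by (rule LIMSEQ_unique)
    next
      fix c x assume x: "x \<in> closure V"
      have "(\<lambda>n. S (c *\<^sub>C a x n)) \<longlonglongrightarrow> T (c *\<^sub>C x)"
        by (intro lim csubspaceD(3)[OF clV] csubspaceD(3)[OF V] tendsto_scaleC a x)
      moreover have "(\<lambda>n. S (c *\<^sub>C a x n)) \<longlonglongrightarrow> c *\<^sub>C T x"
        using tendsto_scaleC[OF Sa[OF x]] by (simp add: S_scale a x)
      ultimately show "T (c *\<^sub>C x) = c *\<^sub>C T x" by (rule LIMSEQ_unique)
    qed
    show "norm (T x) \<le> K * norm x" if "x \<in> closure V" for x
      using LIMSEQ_le[OF tendsto_norm[OF Sa[OF that]]
          tendsto_mult_left[OF tendsto_norm[OF a(2)[OF that]]]] S_norm a(1)[OF that] by blast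
    show "\<theta> x y = cinner (T x) y" if "x \<in> V" "y \<in> V" for x y
      using S_eq[OF that] TS[OF that(1)] by simp
  qed
qed


section \<open>Graphs of closable operators\<close>

text \<open>The adjoint is defined on the dense set \<open>D\<close>. The identity
  \<open>cinner (A \<xi>) \<eta> = cinner \<xi> \<zeta>\<close> survives limits of graph points, so
  the first component of a limit fixes the inner products of the second with every
  \<open>\<eta>\<close> in \<open>D\<close>.\<close>

lemma closable_L_dagger:
  fixes D :: "'h::complex_hilbert_space set"
  assumes dense: "closure D = UNIV" and A: "A \<in> L_dagger D"
  shows "closable D A"
  unfolding closable_def
proof (rule single_valuedI)
  fix x y z assume xy: "(x, y) \<in> closure (op_graph D A)" and xz: "(x, z) \<in> closure (op_graph D A)"
  have adjoint: "cinner w \<eta> = cinner x \<zeta>"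
    if "(x, w) \<in> closure (op_graph D A)" and \<zeta>: "\<forall>\<xi>\<in>D. cinner (A \<xi>) \<eta> = cinner \<xi> \<zeta>" for w \<eta> \<zeta>
  proof -
    obtain p where p: "\<And>n. p n \<in> op_graph D A" "p \<longlonglongrightarrow> (x, w)"
      using \<open>(x, w) \<in> _\<close> unfolding closure_sequential by blast
    have "(\<lambda>n. cinner (fst (p n)) \<zeta>) \<longlonglongrightarrow> cinner (fst (x, w)) \<zeta>"
      "(\<lambda>n. cinner (snd (p n)) \<eta>) \<longlonglongrightarrow> cinner (snd (x, w)) \<eta>"
      by (intro tendsto_intros p)+
    moreover have "cinner (fst (p n)) \<zeta> = cinner (snd (p n)) \<eta>" for n
      using p(1)[of n] \<zeta> by (auto simp: op_graph_def)
    ultimately show ?thesis using LIMSEQ_unique by fastforce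
  qed
  have "y - z = 0"
  proof (rule orthogonal_closure_eq_0)
    show "y - z \<in> closure D" using dense by simp
    fix \<eta> assume "\<eta> \<in> D"
    then have "\<eta> \<in> adj_dom D A" using A by (auto simp: L_dagger_def)
    then obtain \<zeta> where "\<forall>\<xi>\<in>D. cinner (A \<xi>) \<eta> = cinner \<xi> \<zeta>" by (auto simp: adj_dom_def)
    then show "cinner (y - z) \<eta> = 0"
      using adjoint[OF xy] adjoint[OF xz] unfolding cinner_diff_left by fastforce
  qed
  then show "y = z" by simp
qed

lemma closure_op_eq:
  assumes "closable D A" "(\<xi>, \<zeta>) \<in> closure (op_graph D A)"
  shows "closure_op D A \<xi> = \<zeta>"
  using assms unfolding closure_op_def closable_def by (auto dest: single_valuedD)

text \<open>Resolves the \<open>THE\<close> in \<open>closure_op\<close>: the closed subspace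
  \<open>closure (op_graph D A)\<close> of H x H is the graph of \<open>closure_op D A\<close>, and
  properties of the closed operator are read off from it.\<close>

lemma mem_closure_op_graph:
  assumes "closable D A"
  shows "(\<xi>, \<zeta>) \<in> closure (op_graph D A) \<longleftrightarrow> \<xi> \<in> closure_dom D A \<and> \<zeta> = closure_op D A \<xi>"
  using closure_op_eq[OF assms] by (auto simp: closure_dom_def)

lemma closure_op_extends:
  assumes "closable D A" "\<xi> \<in> D"
  shows "\<xi> \<in> closure_dom D A" "closure_op D A \<xi> = A \<xi>"
proof -
  have "(\<xi>, A \<xi>) \<in> closure (op_graph D A)"
    using assms(2) closure_subset by (fastforce simp: op_graph_def)
  then show "\<xi> \<in> closure_dom D A" "closure_op D A \<xi> = A \<xi>"
    by (simp_all add: mem_closure_op_graph[OF assms(1)])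
qed

text \<open>Together with the next lemma, this identifies the Hilbert space \<open>H\<^sub>A\<close>
  with the closed graph inside H x H.\<close>

lemma graph_norm_eq_norm: "graph_norm A \<xi> = norm (\<xi>, A \<xi>)"
  by (simp add: graph_norm_def norm_Pair)

lemma graph_inner_eq_cinner: "graph_inner A \<xi> \<eta> = cinner (\<xi>, A \<xi>) (\<eta>, A \<eta>)"
  by (simp add: graph_inner_def cinner_prod_def)

lemma csubspace_op_graph:
  assumes "csubspace D" "clinear_on D A"
  shows "csubspace (op_graph D A)"
  using csubspaceD[OF assms(1)] clinear_onD[OF assms(2)] clinear_on_0[OF assms(2,1)]
  by (auto simp: csubspace_def op_graph_def scaleC_prod_def zero_prod_def)

lemma closure_op_clinear:
  assumes "csubspace D" "clinear_on D A" "closable D A"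
  shows "csubspace (closure_dom D A)" "clinear_on (closure_dom D A) (closure_op D A)"
proof -
  note cl = csubspace_closure[OF csubspace_op_graph[OF assms(1,2)]]
  note mem = mem_closure_op_graph[OF assms(3)]
  have zero: "0 \<in> closure_dom D A"
    using csubspaceD(1)[OF cl] by (simp add: zero_prod_def mem)
  have add: "\<xi> + \<eta> \<in> closure_dom D A \<and> closure_op D A (\<xi> + \<eta>) = closure_op D A \<xi> + closure_op D A \<eta>"
    if "\<xi> \<in> closure_dom D A" "\<eta> \<in> closure_dom D A" for \<xi> \<eta>
    using csubspaceD(2)[OF cl, of "(\<xi>, closure_op D A \<xi>)" "(\<eta>, closure_op D A \<eta>)"] that
    by (simp add: mem)
  have scale: "c *\<^sub>C \<xi> \<in> closure_dom D A \<and> closure_op D A (c *\<^sub>C \<xi>) = c *\<^sub>C closure_op D A \<xi>"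
    if "\<xi> \<in> closure_dom D A" for c \<xi>
    using csubspaceD(3)[OF cl, of "(\<xi>, closure_op D A \<xi>)" c] that
    by (simp add: mem scaleC_prod_def)
  show "csubspace (closure_dom D A)" "clinear_on (closure_dom D A) (closure_op D A)"
    using zero add scale by (simp_all add: csubspace_def clinear_on_def)
qed

text \<open>The graph of a continuous map on the whole space is closed, and the continuous map
  \<open>x \<mapsto> (x, T x)\<close> carries \<open>closure D\<close> into the closure of its image
  of \<open>D\<close>. The lemma serves both the zero operator and the bounded operator of statement
  (i).\<close>

lemma closure_op_graph_of_dense_bounded:
  fixes T :: "'h::complex_inner_space \<Rightarrow> 'h"
  assumes dense: "closure D = UNIV" and T: "continuous_on UNIV T"
  shows "closure (op_graph D T) = op_graph UNIV T"
proof
  have "op_graph UNIV T = {p. snd p = T (fst p)}" by (auto simp: op_graph_def)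
  moreover have "closed {p. snd p = T (fst p)}"
    by (intro closed_Collect_eq continuous_intros continuous_on_compose2[OF T]) auto
  ultimately show "closure (op_graph D T) \<subseteq> op_graph UNIV T"
    by (intro closure_minimal) (auto simp: op_graph_def)
  have "(\<lambda>x. (x, T x)) ` closure D \<subseteq> closure (op_graph D T)"
    using closure_subset[of "op_graph D T"]
    by (intro image_closure_subset continuous_intros continuous_on_subset[OF T])
      (auto simp: op_graph_def)
  then show "op_graph UNIV T \<subseteq> closure (op_graph D T)"
    using dense by (auto simp: op_graph_def)
qed


section \<open>Bounded forms and bounded elements\<close>

definition bounded_form :: "'h::complex_inner_space set \<Rightarrow> ('h \<Rightarrow> 'h \<Rightarrow> complex) \<Rightarrow> bool" where
  "bounded_form D X \<longleftrightarrow> (\<exists>K\<ge>0. \<forall>\<xi>\<in>D. \<forall>\<eta>\<in>D. cmod (X \<xi> \<eta>) \<le> K * norm \<xi> * norm \<eta>)"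

lemma bounded_formI:
  assumes "\<And>\<xi> \<eta>. \<xi> \<in> D \<Longrightarrow> \<eta> \<in> D \<Longrightarrow> cmod (X \<xi> \<eta>) \<le> K * norm \<xi> * norm \<eta>"
  shows "bounded_form D X"
  \<comment> \<open>The constants supplied by \<open>B_HA\<close> and
    \<open>closure_bounded_everywhere\<close> come without a sign; \<open>max K 0\<close> provides
    the nonnegative one that the Riesz argument asks for.\<close>
  unfolding bounded_form_def
proof (intro exI[of _ "max K 0"] conjI ballI)
  fix \<xi> \<eta> assume "\<xi> \<in> D" "\<eta> \<in> D"
  then have "cmod (X \<xi> \<eta>) \<le> K * norm \<xi> * norm \<eta>" by (rule assms)
  also have "\<dots> \<le> max K 0 * norm \<xi> * norm \<eta>" by (intro mult_right_mono) auto
  finally show "cmod (X \<xi> \<eta>) \<le> max K 0 * norm \<xi> * norm \<eta>" .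
qed simp

lemma bounded_form_represented:
  assumes "\<And>\<xi> \<eta>. \<xi> \<in> D \<Longrightarrow> \<eta> \<in> D \<Longrightarrow> X \<xi> \<eta> = cinner (T \<xi>) \<eta>"
    and "\<And>\<xi>. \<xi> \<in> D \<Longrightarrow> norm (T \<xi>) \<le> K * norm \<xi>"
  shows "bounded_form D X"
proof (rule bounded_formI)
  fix \<xi> \<eta> assume "\<xi> \<in> D" "\<eta> \<in> D"
  then have "cmod (X \<xi> \<eta>) \<le> norm (T \<xi>) * norm \<eta>" by (simp add: assms(1) cmod_cinner_le)
  also have "\<dots> \<le> K * norm \<xi> * norm \<eta>" using assms(2) \<open>\<xi> \<in> D\<close> by (intro mult_right_mono) auto
  finally show "cmod (X \<xi> \<eta>) \<le> K * norm \<xi> * norm \<eta>" .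
qed

lemma L_B_D:
  assumes "X \<in> L_B D"
  shows "\<xi> \<in> D \<Longrightarrow> \<xi>' \<in> D \<Longrightarrow> \<eta> \<in> D \<Longrightarrow> X (\<xi> + \<xi>') \<eta> = X \<xi> \<eta> + X \<xi>' \<eta>"
    and "\<xi> \<in> D \<Longrightarrow> \<eta> \<in> D \<Longrightarrow> X (c *\<^sub>C \<xi>) \<eta> = c * X \<xi> \<eta>"
    and "\<xi> \<in> D \<Longrightarrow> \<eta> \<in> D \<Longrightarrow> \<eta>' \<in> D \<Longrightarrow> X \<xi> (\<eta> + \<eta>') = X \<xi> \<eta> + X \<xi> \<eta>'"
    and "\<xi> \<in> D \<Longrightarrow> \<eta> \<in> D \<Longrightarrow> X \<xi> (c *\<^sub>C \<eta>) = cnj c * X \<xi> \<eta>"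
    and "\<xi> \<in> D \<Longrightarrow> X \<xi> \<in> extensional D"
proof -
  have "X \<xi> \<in> conj_dual D" if "\<xi> \<in> D" for \<xi> using assms that by (auto simp: L_B_def)
  then show "\<xi> \<in> D \<Longrightarrow> \<eta> \<in> D \<Longrightarrow> \<eta>' \<in> D \<Longrightarrow> X \<xi> (\<eta> + \<eta>') = X \<xi> \<eta> + X \<xi> \<eta>'"
    and "\<xi> \<in> D \<Longrightarrow> \<eta> \<in> D \<Longrightarrow> X \<xi> (c *\<^sub>C \<eta>) = cnj c * X \<xi> \<eta>"
    and "\<xi> \<in> D \<Longrightarrow> X \<xi> \<in> extensional D"
    by (simp_all add: conj_dual_def)
qed (use assms in \<open>simp_all add: L_B_def\<close>)

text \<open>Evaluated on first components, \<open>X\<close> is a form on the graph of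
  \<open>A\<close>, still bounded by \<open>K\<close> because a component is no longer than its
  pair. Representing this form on the closed graph gives the operator on \<open>H\<^sub>A\<close>.
  The bound is the same \<open>K\<close> for every \<open>A\<close>, which makes the supremum
  \<open>norm_b\<close> finite.\<close>

lemma ex_representative:
  fixes D :: "'h::complex_hilbert_space set"
  assumes D: "csubspace D" and dense: "closure D = UNIV" and X: "X \<in> L_B D" and A: "A \<in> L_dagger D"
    and K: "0 \<le> K" and bound: "\<And>\<xi> \<eta>. \<xi> \<in> D \<Longrightarrow> \<eta> \<in> D \<Longrightarrow> cmod (X \<xi> \<eta>) \<le> K * norm \<xi> * norm \<eta>"
  obtains T where "is_representative D A X T"
    "\<And>\<xi>. \<xi> \<in> closure_dom D A \<Longrightarrow>
      graph_norm (closure_op D A) (T \<xi>) \<le> K * graph_norm (closure_op D A) \<xi>"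
proof -
  let ?G = "op_graph D A" and ?E = "closure_dom D A" and ?B = "closure_op D A"
  have lin: "clinear_on D A" using A by (simp add: L_dagger_def)
  note cl = closable_L_dagger[OF dense A]
  note mem = mem_closure_op_graph[OF cl]
  note V = csubspace_op_graph[OF D lin]
  have fst_G: "fst p \<in> D" if "p \<in> ?G" for p using that by (auto simp: op_graph_def)
  obtain S where S: "S \<in> closure ?G \<rightarrow> closure ?G" "clinear_on (closure ?G) S"
    and S_norm: "\<And>p. p \<in> closure ?G \<Longrightarrow> norm (S p) \<le> K * norm p"
    and S_eq: "\<And>p q. p \<in> ?G \<Longrightarrow> q \<in> ?G \<Longrightarrow> X (fst p) (fst q) = cinner (S p) q"
  proof (rule bounded_form_representation[OF V K, of "\<lambda>p q. X (fst p) (fst q)"])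
    fix p q assume p: "p \<in> ?G" and q: "q \<in> ?G"
    have "cmod (X (fst p) (fst q)) \<le> K * norm (fst p) * norm (fst q)"
      using bound fst_G p q by blast
    also have "\<dots> \<le> K * norm p * norm q"
      using K norm_fst_le[of "fst p" "snd p"] norm_fst_le[of "fst q" "snd q"]
      by (intro mult_mono) auto
    finally show "cmod (X (fst p) (fst q)) \<le> K * norm p * norm q" .
  qed (use fst_G L_B_D[OF X] in \<open>auto simp: scaleC_prod_def\<close>)
  \<comment> \<open>A point of the closed graph is determined by its first component, so passing to
    \<open>fst\<close> loses nothing. The restriction to \<open>?E\<close> makes \<open>T\<close>
    extensional, as \<open>B_HA\<close> demands.\<close>
  define T where "T = (\<lambda>\<xi>\<in>?E. fst (S (\<xi>, ?B \<xi>)))"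
  have graph: "(\<xi>, ?B \<xi>) \<in> closure ?G" if "\<xi> \<in> ?E" for \<xi> using that mem by blast
  have S_T: "T \<xi> \<in> ?E \<and> S (\<xi>, ?B \<xi>) = (T \<xi>, ?B (T \<xi>))" if "\<xi> \<in> ?E" for \<xi>
  proof -
    have "(fst (S (\<xi>, ?B \<xi>)), snd (S (\<xi>, ?B \<xi>))) \<in> closure ?G"
      using S(1) graph[OF that] by auto
    then show ?thesis using that unfolding mem by (simp add: T_def prod_eq_iff)
  qed
  note E = closure_op_clinear[OF D lin cl]
  note E_simps = csubspaceD(2,3)[OF E(1)] clinear_onD[OF E(2)]
  have T_norm: "graph_norm ?B (T \<xi>) \<le> K * graph_norm ?B \<xi>" if "\<xi> \<in> ?E" for \<xi>
    using S_norm[OF graph[OF that]] S_T[OF that] by (simp add: graph_norm_eq_norm)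
  have "clinear_on ?E T"
    unfolding clinear_on_def
  proof (intro conjI ballI allI)
    fix \<xi> \<eta> assume "\<xi> \<in> ?E" "\<eta> \<in> ?E"
    then show "T (\<xi> + \<eta>) = T \<xi> + T \<eta>"
      using clinear_onD(1)[OF S(2) graph graph, of \<xi> \<eta>] by (simp add: E_simps T_def)
  next
    fix \<xi> c assume "\<xi> \<in> ?E"
    then show "T (c *\<^sub>C \<xi>) = c *\<^sub>C T \<xi>"
      using clinear_onD(2)[OF S(2) graph, of \<xi> c] by (simp add: E_simps T_def scaleC_prod_def)
  qed
  moreover have "T \<in> ?E \<rightarrow>\<^sub>E ?E" using S_T by (auto simp: T_def)
  ultimately have "T \<in> B_HA D A" using T_norm by (auto simp: B_HA_def)
  moreover have "X \<xi> \<eta> = graph_inner ?B (T \<xi>) \<eta>" if "\<xi> \<in> D" "\<eta> \<in> D" for \<xi> \<eta>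
  proof -
    have "X \<xi> \<eta> = cinner (S (\<xi>, A \<xi>)) (\<eta>, A \<eta>)"
      using S_eq[of "(\<xi>, A \<xi>)" "(\<eta>, A \<eta>)"] that by (auto simp: op_graph_def)
    then show ?thesis
      using S_T[of \<xi>] closure_op_extends[OF cl] that by (simp add: graph_inner_eq_cinner)
  qed
  ultimately show ?thesis using that T_norm by (auto simp: is_representative_def)
qed

text \<open>Convergence of the pairs is convergence in the graph norm, for which \<open>T\<close> is
  bounded, and the graph norm dominates the norm of H. Values of \<open>T\<close> on the closed
  domain are thus limits of its values on \<open>D\<close>.\<close>

lemma tendsto_B_HA:
  fixes D :: "'h::complex_hilbert_space set"
  assumes D: "csubspace D" and cl: "closable D A" and lin: "clinear_on D A" and T: "T \<in> B_HA D A"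
    and x: "x \<in> closure_dom D A" and u: "\<And>n. u n \<in> D"
    and lim: "(\<lambda>n. (u n, A (u n))) \<longlonglongrightarrow> (x, closure_op D A x)"
  shows "(\<lambda>n. T (u n)) \<longlonglongrightarrow> T x"
proof -
  let ?E = "closure_dom D A" and ?B = "closure_op D A"
  note E = closure_op_clinear[OF D lin cl]
  obtain K where K: "\<And>\<xi>. \<xi> \<in> ?E \<Longrightarrow> graph_norm ?B (T \<xi>) \<le> K * graph_norm ?B \<xi>"
    using T by (auto simp: B_HA_def)
  have le: "norm (T (u n) - T x) \<le> K * norm ((u n, A (u n)) - (x, ?B x))" for n
  proof -
    note un = closure_op_extends[OF cl u, of n]
    have diff: "u n - x \<in> ?E" "?B (u n - x) = A (u n) - ?B x"
      using csubspaceD(5)[OF E(1)] clinear_on_diff[OF E(2,1)] un x by simp_all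
    have "T (u n - x) = T (u n) - T x"
      using T un x E(1) by (intro clinear_on_diff) (auto simp: B_HA_def)
    then have "norm (T (u n) - T x) \<le> graph_norm ?B (T (u n - x))"
      using norm_fst_le[of "T (u n - x)" "?B (T (u n - x))"] by (simp add: graph_norm_eq_norm)
    also have "\<dots> \<le> K * norm ((u n, A (u n)) - (x, ?B x))"
      using K[OF diff(1)] by (simp add: graph_norm_eq_norm diff(2))
    finally show ?thesis .
  qed
  have "(\<lambda>n. K * norm ((u n, A (u n)) - (x, ?B x))) \<longlonglongrightarrow> K * norm ((x, ?B x) - (x, ?B x))"
    by (intro tendsto_intros lim)
  then have "(\<lambda>n. K * norm ((u n, A (u n)) - (x, ?B x))) \<longlonglongrightarrow> 0"
    by (simp only: diff_self norm_zero mult_zero_right)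
  then have "(\<lambda>n. T (u n) - T x) \<longlonglongrightarrow> 0"
    by (rule Lim_null_comparison[OF always_eventually[OF allI[OF le]]])
  then show ?thesis by (simp add: LIM_zero_iff)
qed

text \<open>Justifies the \<open>THE\<close> in \<open>representative\<close>. On \<open>D\<close>,
  the graph points over \<open>T \<xi>\<close> and \<open>T' \<xi>\<close> have a difference in the
  closed graph that is orthogonal to the graph of \<open>A\<close>. Graph-norm density of
  \<open>D\<close> extends the equality to the closed domain, and off that domain both maps are
  \<open>undefined\<close>.\<close>

lemma representative_unique:
  fixes D :: "'h::complex_hilbert_space set"
  assumes D: "csubspace D" and dense: "closure D = UNIV" and A: "A \<in> L_dagger D"
    and T: "is_representative D A X T" and T': "is_representative D A X T'"
  shows "T = T'"
proof
  fix x
  let ?G = "op_graph D A" and ?E = "closure_dom D A" and ?B = "closure_op D A"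
  have lin: "clinear_on D A" using A by (simp add: L_dagger_def)
  note cl = closable_L_dagger[OF dense A]
  note mem = mem_closure_op_graph[OF cl]
  note clV = csubspace_closure[OF csubspace_op_graph[OF D lin]]
  have B: "T \<in> B_HA D A" "T' \<in> B_HA D A"
    using T T' by (simp_all add: is_representative_def)
  have eq_D: "T \<xi> = T' \<xi>" if \<xi>: "\<xi> \<in> D" for \<xi>
  proof -
    have "T \<xi> \<in> ?E" "T' \<xi> \<in> ?E"
      using B closure_op_extends(1)[OF cl \<xi>] by (auto simp: B_HA_def)
    then have "(T \<xi>, ?B (T \<xi>)) - (T' \<xi>, ?B (T' \<xi>)) \<in> closure ?G"
      by (intro csubspaceD(5)[OF clV]) (simp_all add: mem)
    then have "(T \<xi>, ?B (T \<xi>)) - (T' \<xi>, ?B (T' \<xi>)) = 0"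
    proof (rule orthogonal_closure_eq_0)
      fix q assume "q \<in> ?G"
      then obtain \<eta> where \<eta>: "\<eta> \<in> D" "q = (\<eta>, ?B \<eta>)"
        using closure_op_extends(2)[OF cl] by (auto simp: op_graph_def)
      have "graph_inner ?B (T \<xi>) \<eta> = graph_inner ?B (T' \<xi>) \<eta>"
        using T T' \<xi> \<eta>(1) by (simp add: is_representative_def)
      then show "cinner ((T \<xi>, ?B (T \<xi>)) - (T' \<xi>, ?B (T' \<xi>))) q = 0"
        by (simp add: \<eta>(2) graph_inner_eq_cinner cinner_diff_left del: diff_Pair)
    qed
    then show ?thesis by (simp add: zero_prod_def)
  qed
  show "T x = T' x"
  proof (cases "x \<in> ?E")
    case True
    then have "(x, ?B x) \<in> closure ?G" by (simp add: mem)
    then obtain p where p: "\<And>n. p n \<in> ?G" "p \<longlonglongrightarrow> (x, ?B x)"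
      unfolding closure_sequential by blast
    have u: "fst (p n) \<in> D" "p n = (fst (p n), A (fst (p n)))" for n
      using p(1)[of n] by (auto simp: op_graph_def)
    have "(\<lambda>n. (fst (p n), A (fst (p n)))) \<longlonglongrightarrow> (x, ?B x)" using p(2) u(2) by simp
    note lim = tendsto_B_HA[OF D cl lin _ True u(1) this]
    show ?thesis using lim[OF B(1)] lim[OF B(2)] eq_D[OF u(1)] by (simp add: LIMSEQ_unique)
  next
    case False
    then show ?thesis using B by (auto simp: B_HA_def PiE_def extensional_def)
  qed
qed

lemma bounded_form_imp_L_B_bounded:
  fixes D :: "'h::complex_hilbert_space set"
  assumes D: "csubspace D" and dense: "closure D = UNIV" and X: "X \<in> L_B D" and bd: "bounded_form D X"
  shows "X \<in> L_B_bounded D"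
proof -
  obtain K where K: "0 \<le> K" "\<And>\<xi> \<eta>. \<xi> \<in> D \<Longrightarrow> \<eta> \<in> D \<Longrightarrow> cmod (X \<xi> \<eta>) \<le> K * norm \<xi> * norm \<eta>"
    using bd by (auto simp: bounded_form_def)
  have "(\<exists>T. is_representative D A X T) \<and> norm_HA D A (representative D A X) \<le> K"
    if A: "A \<in> L_dagger D" for A
  proof -
    let ?E = "closure_dom D A" and ?B = "closure_op D A"
    obtain T where T: "is_representative D A X T"
      and T_norm: "\<And>\<xi>. \<xi> \<in> ?E \<Longrightarrow> graph_norm ?B (T \<xi>) \<le> K * graph_norm ?B \<xi>"
      using ex_representative[OF D dense X A K] by blast
    have rep: "representative D A X = T"
      unfolding representative_def using T representative_unique[OF D dense A] by blast
    have lin: "clinear_on D A" using A by (simp add: L_dagger_def)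
    note E = closure_op_clinear[OF D lin closable_L_dagger[OF dense A]]
    \<comment> \<open>The unit ball has to be nonempty before the real supremum in
      \<open>norm_HA\<close> can be bounded by \<open>K\<close>.\<close>
    have "0 \<in> ?E" "?B 0 = 0"
      using csubspaceD(1)[OF E(1)] clinear_on_0[OF E(2,1)] .
    then have "0 \<in> {\<xi> \<in> ?E. graph_norm ?B \<xi> \<le> 1}" by (simp add: graph_norm_def)
    moreover have "graph_norm ?B (T \<xi>) \<le> K" if "\<xi> \<in> ?E" "graph_norm ?B \<xi> \<le> 1" for \<xi>
      using T_norm[OF that(1)] mult_left_mono[OF that(2) K(1)] by simp
    ultimately have "norm_HA D A T \<le> K"
      unfolding norm_HA_def by (intro cSUP_least) auto
    then show ?thesis using T rep by auto
  qed
  then have "norm_b D X \<le> ereal K"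
    unfolding norm_b_def by (intro SUP_least) simp
  then have "norm_b D X < \<infinity>" by (rule order.strict_trans1) simp
  then show ?thesis using X \<open>\<And>A. A \<in> L_dagger D \<Longrightarrow> _\<close> by (simp add: L_B_bounded_def)
qed

text \<open>The zero operator is the test operator for which \<open>H\<^sub>A\<close> is H itself.
  Density of \<open>D\<close> makes the \<open>THE\<close> in \<open>adj\<close> evaluate to
  0.\<close>

lemma zero_in_L_dagger:
  fixes D :: "'h::complex_hilbert_space set"
  assumes "csubspace D" "closure D = UNIV"
  shows "(\<lambda>\<xi>\<in>D. 0) \<in> L_dagger D"
proof -
  have "adj D (\<lambda>\<xi>\<in>D. 0) \<eta> = 0" for \<eta>
    unfolding adj_def
  proof (rule the_equality)
    fix \<zeta> assume "\<forall>\<xi>\<in>D. cinner ((\<lambda>\<xi>\<in>D. 0) \<xi>) \<eta> = cinner \<xi> \<zeta>"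
    then have "cinner \<zeta> \<xi> = 0" if "\<xi> \<in> D" for \<xi>
      using that cinner_commute[of \<zeta> \<xi>] by simp
    then show "\<zeta> = 0" using assms(2) by (intro orthogonal_closure_eq_0[of \<zeta> D]) auto
  qed simp
  moreover have "D \<subseteq> adj_dom D (\<lambda>\<xi>\<in>D. 0)"
    unfolding adj_dom_def by (intro subsetI CollectI exI[of _ 0]) simp
  ultimately show ?thesis
    using csubspaceD[OF assms(1)] by (auto simp: L_dagger_def clinear_on_def)
qed

text \<open>The closed graph of the zero operator is H x {0}, so its graph norm and graph inner
  product are those of H, and the representative is a bounded operator on H inducing
  \<open>X\<close>.\<close>

lemma L_B_bounded_imp_bounded_form:
  fixes D :: "'h::complex_hilbert_space set"
  assumes D: "csubspace D" and dense: "closure D = UNIV" and X: "X \<in> L_B_bounded D"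
  shows "bounded_form D X"
proof -
  define Z where "Z = (\<lambda>\<xi>\<in>D. 0::'h)"
  have Z: "Z \<in> L_dagger D" unfolding Z_def using D dense by (rule zero_in_L_dagger)
  \<comment> \<open>\<open>Z\<close> is \<open>undefined\<close> off \<open>D\<close>; the constant
    function has the same graph over \<open>D\<close> and is continuous everywhere.\<close>
  have "op_graph D Z = op_graph D (\<lambda>_. 0)" by (auto simp: op_graph_def Z_def)
  then have "closure (op_graph D Z) = op_graph UNIV (\<lambda>_. 0)"
    by (simp add: closure_op_graph_of_dense_bounded[OF dense])
  then have "(\<xi>, 0) \<in> closure (op_graph D Z)" for \<xi> by (auto simp: op_graph_def)
  then have E: "\<xi> \<in> closure_dom D Z" and B: "closure_op D Z \<xi> = 0" for \<xi>
    unfolding mem_closure_op_graph[OF closable_L_dagger[OF dense Z]] by metis+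
  obtain T where T: "is_representative D Z X T"
    using X Z by (auto simp: L_B_bounded_def)
  then have "\<exists>K. \<forall>\<xi>\<in>closure_dom D Z. norm (T \<xi>) \<le> K * norm \<xi>"
    by (simp add: is_representative_def B_HA_def graph_norm_def B)
  then obtain K where "\<And>\<xi>. norm (T \<xi>) \<le> K * norm \<xi>" using E by blast
  then show ?thesis
    using T by (intro bounded_form_represented[of D X T K])
      (auto simp: is_representative_def graph_inner_def B)
qed


section \<open>Maps with values in the Hilbert space\<close>

text \<open>A vector is determined by its inner products with the dense set \<open>D\<close>, so
  \<open>embed D\<close> is injective and the \<open>THE\<close> in \<open>as_operator\<close> is
  meaningful.\<close>

lemma embed_eq_imp_as_operator_eq:
  assumes dense: "closure D = UNIV" and "\<xi> \<in> D" and h: "X \<xi> = embed D h"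
  shows "as_operator D X \<xi> = h"
proof -
  have "h' = h" if h': "X \<xi> = embed D h'" for h'
  proof -
    have "cinner h' \<eta> = cinner h \<eta>" if "\<eta> \<in> D" for \<eta>
      using fun_cong[OF h'[unfolded h], of \<eta>] that by (simp add: embed_def)
    then have "h' - h = 0"
      using dense by (intro orthogonal_closure_eq_0[of _ D]) (auto simp: cinner_diff_left)
    then show ?thesis by simp
  qed
  then show ?thesis using assms by (auto simp: as_operator_def intro: the_equality)
qed

lemma bounded_operator_imp_bounded_form:
  assumes dense: "closure D = UNIV" and X: "maps_into_H D X"
    and cl: "closure_bounded_everywhere D (as_operator D X)"
  shows "bounded_form D X"
proof -
  obtain K where K: "\<And>x. norm (closure_op D (as_operator D X) x) \<le> K * norm x"
    and "closable D (as_operator D X)"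
    using cl by (auto simp: closure_bounded_everywhere_def)
  then have "norm (as_operator D X \<xi>) \<le> K * norm \<xi>" if "\<xi> \<in> D" for \<xi>
    using closure_op_extends(2)[of D _ \<xi>] that by metis
  moreover have "X \<xi> \<eta> = cinner (as_operator D X \<xi>) \<eta>" if "\<xi> \<in> D" "\<eta> \<in> D" for \<xi> \<eta>
  proof -
    have "X \<xi> \<in> range (embed D)" using X that(1) by (simp add: maps_into_H_def image_subset_iff)
    then obtain h where h: "X \<xi> = embed D h" by (rule rangeE)
    then show ?thesis
      using embed_eq_imp_as_operator_eq[of D \<xi> X h] dense that by (simp add: embed_def)
  qed
  ultimately show ?thesis by (intro bounded_form_represented)
qed

text \<open>Since \<open>closure D\<close> is the whole space, the representing operator
  \<open>T\<close> is everywhere defined. It agrees with \<open>as_operator D X\<close> on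
  \<open>D\<close>, and by density and continuity the closure of that common graph is the full graph
  of \<open>T\<close>.\<close>

lemma bounded_form_imp_bounded_operator:
  fixes D :: "'h::complex_hilbert_space set"
  assumes D: "csubspace D" and dense: "closure D = UNIV" and X: "X \<in> L_B D" and bd: "bounded_form D X"
  shows "maps_into_H D X \<and> closure_bounded_everywhere D (as_operator D X)"
proof -
  obtain K where K: "0 \<le> K" "\<And>\<xi> \<eta>. \<xi> \<in> D \<Longrightarrow> \<eta> \<in> D \<Longrightarrow> cmod (X \<xi> \<eta>) \<le> K * norm \<xi> * norm \<eta>"
    using bd by (auto simp: bounded_form_def)
  obtain T where lin: "clinear_on UNIV T" and T_norm: "\<And>x. norm (T x) \<le> K * norm x"
    and T_eq: "\<And>\<xi> \<eta>. \<xi> \<in> D \<Longrightarrow> \<eta> \<in> D \<Longrightarrow> X \<xi> \<eta> = cinner (T \<xi>) \<eta>"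
    by (rule bounded_form_representation[OF D K(1), of X, unfolded dense])
      (simp_all add: L_B_D(1-4)[OF X] K(2))
  \<comment> \<open>Both functionals are extensional, so agreement on \<open>D\<close> is
    equality.\<close>
  have X_eq: "X \<xi> = embed D (T \<xi>)" if "\<xi> \<in> D" for \<xi>
    using L_B_D(5)[OF X that] T_eq[OF that] by (auto simp: embed_def extensional_def)
  have "bounded_linear T"
    using T_norm clinear_onD[OF lin]
    by (intro bounded_linear_intro[of T K]) (auto simp: scaleR_scaleC mult.commute)
  then have "continuous_on UNIV T" by (rule linear_continuous_on)
  moreover have "op_graph D (as_operator D X) = op_graph D T"
    using embed_eq_imp_as_operator_eq[OF dense] X_eq by (auto simp: op_graph_def)
  ultimately have graph: "closure (op_graph D (as_operator D X)) = op_graph UNIV T"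
    by (simp add: closure_op_graph_of_dense_bounded[OF dense])
  then have cl: "closable D (as_operator D X)" and "closure_dom D (as_operator D X) = UNIV"
    by (auto simp: closable_def closure_dom_def op_graph_def single_valued_def)
  moreover have "closure_op D (as_operator D X) = T"
    using closure_op_eq[OF cl, unfolded graph] by (auto simp: op_graph_def)
  moreover have "maps_into_H D X" using X_eq by (auto simp: maps_into_H_def)
  ultimately show ?thesis using lin T_norm by (auto simp: closure_bounded_everywhere_def)
qed


section \<open>Order bounds\<close>

lemma map_leq_iff:
  assumes "\<And>\<xi>. \<xi> \<in> D \<Longrightarrow> X \<xi> \<xi> = complex_of_real (f \<xi>)" "\<And>\<xi>. \<xi> \<in> D \<Longrightarrow> Y \<xi> \<xi> = complex_of_real (g \<xi>)"
  shows "map_leq D X Y \<longleftrightarrow> (\<forall>\<xi>\<in>D. f \<xi> \<le> g \<xi>)"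
  using assms
  by (simp add: map_leq_def map_nonneg_def map_minus_def complex_nonneg_Reals_iff)

lemma map_scale_I_diag:
  "\<xi> \<in> D \<Longrightarrow> map_scale D (complex_of_real c) (map_I D) \<xi> \<xi> = complex_of_real (c * (norm \<xi>)\<^sup>2)"
  by (simp add: map_scale_def map_I_def embed_def cinner_self)

lemma map_Re_diag: "\<xi> \<in> D \<Longrightarrow> map_Re D X \<xi> \<xi> = complex_of_real (Re (X \<xi> \<xi>))"
  by (simp add: map_Re_def map_scale_def map_plus_def map_dagger_def complex_add_cnj)

lemma map_Im_diag: "\<xi> \<in> D \<Longrightarrow> map_Im D X \<xi> \<xi> = complex_of_real (Im (X \<xi> \<xi>))"
  by (simp add: map_Im_def map_scale_def map_minus_def map_dagger_def complex_diff_cnj complex_eq_iff)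

text \<open>The order sees the diagonal only, where \<open>map_Re\<close> and \<open>map_Im\<close>
  yield the real and imaginary parts of \<open>X \<xi> \<xi>\<close> and \<open>map_I\<close> yields
  the squared norm.\<close>

lemma order_bounds_iff:
  "map_leq D (map_scale D (complex_of_real (- c)) (map_I D)) (map_Re D X)
     \<and> map_leq D (map_Re D X) (map_scale D (complex_of_real c) (map_I D))
     \<and> map_leq D (map_scale D (complex_of_real (- c)) (map_I D)) (map_Im D X)
     \<and> map_leq D (map_Im D X) (map_scale D (complex_of_real c) (map_I D))
   \<longleftrightarrow> (\<forall>\<xi>\<in>D. \<bar>Re (X \<xi> \<xi>)\<bar> \<le> c * (norm \<xi>)\<^sup>2 \<and> \<bar>Im (X \<xi> \<xi>)\<bar> \<le> c * (norm \<xi>)\<^sup>2)"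
proof -
  have "map_leq D (map_scale D (complex_of_real (- c)) (map_I D)) (map_Re D X)
      \<longleftrightarrow> (\<forall>\<xi>\<in>D. - c * (norm \<xi>)\<^sup>2 \<le> Re (X \<xi> \<xi>))"
    "map_leq D (map_scale D (complex_of_real (- c)) (map_I D)) (map_Im D X)
      \<longleftrightarrow> (\<forall>\<xi>\<in>D. - c * (norm \<xi>)\<^sup>2 \<le> Im (X \<xi> \<xi>))"
    "map_leq D (map_Re D X) (map_scale D (complex_of_real c) (map_I D))
      \<longleftrightarrow> (\<forall>\<xi>\<in>D. Re (X \<xi> \<xi>) \<le> c * (norm \<xi>)\<^sup>2)"
    "map_leq D (map_Im D X) (map_scale D (complex_of_real c) (map_I D))
      \<longleftrightarrow> (\<forall>\<xi>\<in>D. Im (X \<xi> \<xi>) \<le> c * (norm \<xi>)\<^sup>2)"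
    by (intro map_leq_iff map_scale_I_diag map_Re_diag map_Im_diag; assumption)+
  then show ?thesis by (auto simp: abs_le_iff minus_le_iff)
qed

text \<open>Polarization bounds the form by a sum of squared norms; scaling both vectors to norm 1
  turns the sum into a product, with constant \<open>2 * C\<close>.\<close>

lemma bounded_form_of_diagonal:
  fixes D :: "'h::complex_hilbert_space set"
  assumes D: "csubspace D" and X: "X \<in> L_B D" and C: "0 \<le> C"
    and diag: "\<And>\<xi>. \<xi> \<in> D \<Longrightarrow> cmod (X \<xi> \<xi>) \<le> C * (norm \<xi>)\<^sup>2"
  shows "bounded_form D X"
proof (rule bounded_formI)
  have sum: "cmod (X \<xi> \<eta>) \<le> C * ((norm \<xi>)\<^sup>2 + (norm \<eta>)\<^sup>2)" if \<xi>: "\<xi> \<in> D" and \<eta>: "\<eta> \<in> D" for \<xi> \<eta>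
  proof -
    define q where "q c = X (\<xi> + c *\<^sub>C \<eta>) (\<xi> + c *\<^sub>C \<eta>)" for c
    have q: "q c = X \<xi> \<xi> + cnj c * X \<xi> \<eta> + c * X \<eta> \<xi> + c * cnj c * X \<eta> \<eta>" for c
      using \<xi> \<eta> csubspaceD(2,3)[OF D] by (simp add: q_def L_B_D(1-4)[OF X] algebra_simps)
    have norm_q: "cmod (q c) \<le> C * ((norm \<xi>)\<^sup>2 + 2 * Re (cnj c * cinner \<xi> \<eta>) + (norm \<eta>)\<^sup>2)"
      if "cmod c = 1" for c
      using diag[of "\<xi> + c *\<^sub>C \<eta>"] csubspaceD(2,3)[OF D] \<xi> \<eta> that
      by (simp add: q_def norm_add_squared cinner_scaleC_right norm_scaleC)
    \<comment> \<open>Polarization over the fourth roots of unity: with these weights only the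
      coefficient \<open>cnj c\<close> of \<open>X \<xi> \<eta>\<close> survives.\<close>
    have "4 * X \<xi> \<eta> = q 1 - q (-1) + \<i> * q \<i> - \<i> * q (-\<i>)"
      by (simp add: q algebra_simps)
    then have "4 * cmod (X \<xi> \<eta>) = cmod (q 1 - q (-1) + \<i> * q \<i> - \<i> * q (-\<i>))"
      by (metis norm_mult norm_numeral)
    also have "\<dots> \<le> cmod (q 1) + cmod (q (-1)) + cmod (q \<i>) + cmod (q (-\<i>))"
      using norm_triangle_ineq4[of "q 1 - q (-1) + \<i> * q \<i>" "\<i> * q (-\<i>)"]
        norm_triangle_ineq[of "q 1 - q (-1)" "\<i> * q \<i>"] norm_triangle_ineq4[of "q 1" "q (-1)"]
      by (simp add: norm_mult)
    \<comment> \<open>The cross terms \<open>Re (cnj c * cinner \<xi> \<eta>)\<close> cancel because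
      the four values of \<open>c\<close> sum to 0.\<close>
    also have "\<dots> \<le> 4 * (C * ((norm \<xi>)\<^sup>2 + (norm \<eta>)\<^sup>2))"
      using norm_q[of 1] norm_q[of "-1"] norm_q[of \<i>] norm_q[of "-\<i>"] by (simp add: algebra_simps)
    finally show ?thesis by simp
  qed
  fix \<xi> \<eta> assume \<xi>: "\<xi> \<in> D" and \<eta>: "\<eta> \<in> D"
  show "cmod (X \<xi> \<eta>) \<le> 2 * C * norm \<xi> * norm \<eta>"
  \<comment> \<open>A zero vector cannot be normalised; there the form vanishes by
    homogeneity.\<close>
  proof (cases "\<xi> = 0 \<or> \<eta> = 0")
    case True
    then show ?thesis
      using L_B_D(2)[OF X \<xi> \<eta>, of 0] L_B_D(4)[OF X \<xi> \<eta>, of 0] by auto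
  next
    case False
    define a where "a = complex_of_real (inverse (norm \<xi>))"
    define b where "b = complex_of_real (inverse (norm \<eta>))"
    have "norm (a *\<^sub>C \<xi>) = 1" "norm (b *\<^sub>C \<eta>) = 1"
      using False by (simp_all add: a_def b_def norm_scaleC norm_inverse)
    then have "cmod (X (a *\<^sub>C \<xi>) (b *\<^sub>C \<eta>)) \<le> 2 * C"
      using sum[of "a *\<^sub>C \<xi>" "b *\<^sub>C \<eta>"] \<xi> \<eta> csubspaceD(3)[OF D] by simp
    moreover have "cmod (X (a *\<^sub>C \<xi>) (b *\<^sub>C \<eta>)) = cmod (X \<xi> \<eta>) / (norm \<xi> * norm \<eta>)"
      using \<xi> \<eta> csubspaceD(3)[OF D]
      by (simp add: L_B_D(2,4)[OF X] norm_mult a_def b_def norm_inverse divide_inverse)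
    ultimately show ?thesis using False by (simp add: field_simps)
  qed
qed

lemma order_bounds_iff_bounded_form:
  fixes D :: "'h::complex_hilbert_space set"
  assumes D: "csubspace D" and X: "X \<in> L_B D"
  shows "(\<exists>c>0. \<forall>\<xi>\<in>D. \<bar>Re (X \<xi> \<xi>)\<bar> \<le> c * (norm \<xi>)\<^sup>2 \<and> \<bar>Im (X \<xi> \<xi>)\<bar> \<le> c * (norm \<xi>)\<^sup>2)
    \<longleftrightarrow> bounded_form D X"
proof
  assume "\<exists>c>0. \<forall>\<xi>\<in>D. \<bar>Re (X \<xi> \<xi>)\<bar> \<le> c * (norm \<xi>)\<^sup>2 \<and> \<bar>Im (X \<xi> \<xi>)\<bar> \<le> c * (norm \<xi>)\<^sup>2"
  then obtain c where "0 < c"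
    and c: "\<And>\<xi>. \<xi> \<in> D \<Longrightarrow> \<bar>Re (X \<xi> \<xi>)\<bar> \<le> c * (norm \<xi>)\<^sup>2 \<and> \<bar>Im (X \<xi> \<xi>)\<bar> \<le> c * (norm \<xi>)\<^sup>2"
    by blast
  have "cmod (X \<xi> \<xi>) \<le> 2 * c * (norm \<xi>)\<^sup>2" if "\<xi> \<in> D" for \<xi>
    using c[OF that] cmod_le[of "X \<xi> \<xi>"] by linarith
  then show "bounded_form D X"
    using \<open>0 < c\<close> by (intro bounded_form_of_diagonal[OF D X, of "2 * c"]) auto
next
  assume "bounded_form D X"
  then obtain K where "0 \<le> K" and K: "\<And>\<xi> \<eta>. \<xi> \<in> D \<Longrightarrow> \<eta> \<in> D \<Longrightarrow> cmod (X \<xi> \<eta>) \<le> K * norm \<xi> * norm \<eta>"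
    by (auto simp: bounded_form_def)
  \<comment> \<open>The order bound asks for a strictly positive constant, while \<open>K\<close>
    may be 0.\<close>
  have "cmod (X \<xi> \<xi>) \<le> (K + 1) * (norm \<xi>)\<^sup>2" if "\<xi> \<in> D" for \<xi>
    using K[OF that that] by (simp add: power2_eq_square algebra_simps add_increasing)
  then have "\<forall>\<xi>\<in>D. \<bar>Re (X \<xi> \<xi>)\<bar> \<le> (K + 1) * (norm \<xi>)\<^sup>2 \<and> \<bar>Im (X \<xi> \<xi>)\<bar> \<le> (K + 1) * (norm \<xi>)\<^sup>2"
    using abs_Re_le_cmod abs_Im_le_cmod order_trans by blast
  then show "\<exists>c>0. \<forall>\<xi>\<in>D. \<bar>Re (X \<xi> \<xi>)\<bar> \<le> c * (norm \<xi>)\<^sup>2 \<and> \<bar>Im (X \<xi> \<xi>)\<bar> \<le> c * (norm \<xi>)\<^sup>2"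
    using \<open>0 \<le> K\<close> by (intro exI[of _ "K + 1"]) auto
qed

theorem theorem3p5:
  fixes D :: "'h::complex_hilbert_space set"
    and X :: "'h \<Rightarrow> 'h \<Rightarrow> complex"
  assumes "csubspace D" and "closure D = UNIV"
    and "X \<in> L_B D"
  shows "(maps_into_H D X \<and> closure_bounded_everywhere D (as_operator D X)
            \<longleftrightarrow> X \<in> L_B_bounded D)
       \<and> (X \<in> L_B_bounded D
            \<longleftrightarrow> (\<exists>c::real. c > 0
                 \<and> map_leq D (map_scale D (complex_of_real (- c)) (map_I D)) (map_Re D X)
                 \<and> map_leq D (map_Re D X) (map_scale D (complex_of_real c) (map_I D))
                 \<and> map_leq D (map_scale D (complex_of_real (- c)) (map_I D)) (map_Im D X)
                 \<and> map_leq D (map_Im D X) (map_scale D (complex_of_real c) (map_I D))))"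
  unfolding order_bounds_iff order_bounds_iff_bounded_form[OF assms(1,3)]
  using bounded_operator_imp_bounded_form[OF assms(2)] bounded_form_imp_bounded_operator[OF assms]
    bounded_form_imp_L_B_bounded[OF assms] L_B_bounded_imp_bounded_form[OF assms(1,2)]
  by blast

end
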